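(* Let $\mathcal{A}$ be a complex Banach *-algebra with identity, and let $a,b\in\mathcal{A}$ be p-core invertible elements such that $ab=ba$ and $a^*b=ba^*$. Then the following are equivalent: (1) $a+b$ is p-core invertible and $a^{\pi}(a+b)^{\mathrm{pc}}aa^{\mathrm{pc}}=0$. (2) $1+a^{\mathrm{pc}}b$ is p-core invertible and $$\sum_{i=1}^{m}\,[1+a^{\mathrm{pc}}b]^{i-1}\,a^{i-1}\,[1+a^{\mathrm{pc}}b]^{\pi}\,a\,[aa^{\mathrm{pc}}-a^{\mathrm{pc}}a]\,(a+b)^{m-i}=0$$ for some integer $m\geq i(1+a^{\mathrm{pc}}b)$.
   Context: A Banach *-algebra is a complex Banach algebra $\mathcal{A}$ with identity $1$ together with an involution $*$, i.e. an anti-automorphism whose square is the identity map ($(x+y)^*=x^*+y^*$, $(xy)^*=y^*x^*$, $(x^* )^*=x$; conjugate-linear as usual). An element $a\in\mathcal{A}$ is p-core invertible (has a pseudo core inverse) if there exist $x\in\mathcal{A}$ and $k\in\mathbb{N}$ with $xa^{k+1}=a^k$, $ax^2=x$, $(ax)^*=ax$. Such an $x$ is unique if it exists and is denoted $a^{\mathrm{pc}}$. An element $a$ is Drazin invertible if there exist $x\in\mathcal{A}$ and $k$ with $xa^{k+1}=a^k$, $ax^2=x$, $ax=xa$; $x$ is unique, is denoted $a^D$, and the smallest nonnegative such $k$ is the index $i(a)$ (with $a^0=1$). For Drazin invertible $a$, $a^{\pi}=1-aa^D$. Every p-core invertible element is Drazin invertible, so $a^\pi$, $[1+a^{\mathrm{pc}}b]^{\pi}$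 and $i(1+a^{\mathrm{pc}}b)$ are meaningful whenever the elements concerned are p-core invertible. *)

theory Defs
  imports "HOL-Analysis.Analysis"
begin

text \<open>
  Unital complex Banach algebras. The unit comes from \<^class>\<open>monoid_mult\<close> rather than from
  \<^class>\<open>real_normed_algebra_1\<close>, so that neither \<open>norm 1 = 1\<close> nor \<open>0 \<noteq> 1\<close> is imposed.
\<close>

class complex_banach_algebra_1 = real_normed_algebra + monoid_mult + banach +
  fixes scaleC :: "complex \<Rightarrow> 'a \<Rightarrow> 'a"  (infixr \<open>*\<^sub>C\<close> 75)
  assumes scaleC_add_right: "c *\<^sub>C (x + y) = c *\<^sub>C x + c *\<^sub>C y"
    and scaleC_add_left: "(c + d) *\<^sub>C x = c *\<^sub>C x + d *\<^sub>C x"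
    and scaleC_scaleC: "c *\<^sub>C d *\<^sub>C x = (c * d) *\<^sub>C x"
    and scaleR_eq_scaleC: "r *\<^sub>R x = complex_of_real r *\<^sub>C x"
    and mult_scaleC_left: "(c *\<^sub>C x) * y = c *\<^sub>C (x * y)"
    and mult_scaleC_right: "x * (c *\<^sub>C y) = c *\<^sub>C (x * y)"
    and norm_scaleC: "norm (c *\<^sub>C x) = cmod c * norm x"

text \<open>No continuity of the involution and no C*-identity is assumed.\<close>

class banach_star_algebra = complex_banach_algebra_1 +
  fixes star :: "'a \<Rightarrow> 'a"
  assumes star_add: "star (x + y) = star x + star y"
    and star_scaleC: "star (c *\<^sub>C x) = cnj c *\<^sub>C star x"
    and star_mult: "star (x * y) = star y * star x"
    and star_star: "star (star x) = x"

definition is_pc_inverse :: "'a::banach_star_algebra \<Rightarrow> 'a \<Rightarrow> bool" where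
  "is_pc_inverse a x \<longleftrightarrow>
     (\<exists>k::nat. x * a ^ (k + 1) = a ^ k \<and> a * x ^ 2 = x \<and> star (a * x) = a * x)"

definition pc_invertible :: "'a::banach_star_algebra \<Rightarrow> bool" where
  "pc_invertible a \<longleftrightarrow> (\<exists>x. is_pc_inverse a x)"

definition pc :: "'a::banach_star_algebra \<Rightarrow> 'a" where
  "pc a = (THE x. is_pc_inverse a x)"

definition is_drazin_inverse_at :: "nat \<Rightarrow> 'a::banach_star_algebra \<Rightarrow> 'a \<Rightarrow> bool" where
  "is_drazin_inverse_at k a x \<longleftrightarrow> x * a ^ (k + 1) = a ^ k \<and> a * x ^ 2 = x \<and> a * x = x * a"

definition drazin_invertible :: "'a::banach_star_algebra \<Rightarrow> bool" where
  "drazin_invertible a \<longleftrightarrow> (\<exists>x k. is_drazin_inverse_at k a x)"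

definition drazin :: "'a::banach_star_algebra \<Rightarrow> 'a" where
  "drazin a = (THE x. \<exists>k. is_drazin_inverse_at k a x)"

definition drazin_index :: "'a::banach_star_algebra \<Rightarrow> nat" where
  "drazin_index a = (LEAST k. \<exists>x. is_drazin_inverse_at k a x)"

definition spectral_idem :: "'a::banach_star_algebra \<Rightarrow> 'a" where
  "spectral_idem a = 1 - a * drazin a"

text \<open>
  Both inverses are unique and every pseudo core invertible element is Drazin invertible, so
  the descriptions above denote the intended elements whenever the statement uses them.
\<close>

lemma left_inverse_power_mono:
  fixes a x :: "'a::banach_star_algebra"
  assumes "x * a ^ (k + 1) = a ^ k" "k \<le> n"
  shows "x * a ^ (n + 1) = a ^ n"
proof -
  have 1: "a ^ (n + 1) = a ^ (k + 1) * a ^ (n - k)" and 2: "a ^ n = a ^ k * a ^ (n - k)"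
    using assms(2) by (simp_all only: power_add[symmetric]) simp_all
  show ?thesis
    by (simp only: 1 2 mult.assoc[symmetric] assms(1))
qed

lemma outer_inverse_power:
  fixes a x :: "'a::banach_star_algebra"
  assumes "a * x ^ 2 = x"
  shows "a ^ n * x ^ (n + 1) = x"
proof (induction n)
  case (Suc n)
  have "a ^ Suc n * x ^ (Suc n + 1) = a ^ n * (a * x ^ 2) * x ^ n"
    by (simp add: power_commutes[symmetric] power2_eq_square mult.assoc)
  also have "\<dots> = a ^ n * x ^ (n + 1)"
    using assms by (simp add: mult.assoc)
  finally show ?case
    using Suc by simp
qed simp

lemma absorb_common:
  fixes a u v :: "'a::banach_star_algebra"
  assumes "u * a ^ (n + 1) = a ^ n" "a ^ n * v ^ (n + 1) = v"
  shows "u * (a * v) = v"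
proof -
  have "u * (a * v) = u * (a * (a ^ n * v ^ (n + 1)))"
    by (simp only: assms(2))
  also have "\<dots> = (u * a ^ (n + 1)) * v ^ (n + 1)"
    by (simp only: mult.assoc Suc_eq_plus1[symmetric] power_Suc)
  also have "\<dots> = v"
    by (simp only: assms)
  finally show ?thesis .
qed

lemma is_pc_inverse_unique:
  assumes "is_pc_inverse a x" "is_pc_inverse a y"
  shows "x = y"
proof -
  obtain k where k: "x * a ^ (k + 1) = a ^ k" "a * x ^ 2 = x" "star (a * x) = a * x"
    using assms(1) unfolding is_pc_inverse_def by blast
  obtain l where l: "y * a ^ (l + 1) = a ^ l" "a * y ^ 2 = y" "star (a * y) = a * y"
    using assms(2) unfolding is_pc_inverse_def by blast
  define n where "n = max k l"
  have x: "x * a ^ (n + 1) = a ^ n" and y: "y * a ^ (n + 1) = a ^ n"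
    using left_inverse_power_mono[OF k(1)] left_inverse_power_mono[OF l(1)] unfolding n_def
    by (meson max.cobounded1 max.cobounded2)+
  note x' = outer_inverse_power[OF k(2), of n] and y' = outer_inverse_power[OF l(2), of n]
  have xy: "(a * x) * (a * y) = a * y" and yx: "(a * y) * (a * x) = a * x"
    by (simp_all only: mult.assoc absorb_common[OF x y'] absorb_common[OF y x'])
  have "a * x = star ((a * y) * (a * x))"
    by (simp only: yx k(3))
  also have "\<dots> = (a * x) * (a * y)"
    by (simp only: star_mult[of "a * y" "a * x"] k(3) l(3))
  finally have "a * x = a * y"
    by (simp only: xy)
  then have "x * (a * x) = x * (a * y)"
    by (rule arg_cong)
  then show ?thesis
    by (simp only: absorb_common[OF x x'] absorb_common[OF x y'])
qed

lemma is_drazin_inverse_at_unique: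
  assumes "is_drazin_inverse_at k a x" "is_drazin_inverse_at l a y"
  shows "x = y"
proof -
  have k: "x * a ^ (k + 1) = a ^ k" "a * x ^ 2 = x" "a * x = x * a"
    and l: "y * a ^ (l + 1) = a ^ l" "a * y ^ 2 = y" "a * y = y * a"
    using assms unfolding is_drazin_inverse_at_def by blast+
  define n where "n = max k l"
  have x: "x * a ^ (n + 1) = a ^ n" and y: "y * a ^ (n + 1) = a ^ n"
    using left_inverse_power_mono[OF k(1)] left_inverse_power_mono[OF l(1)] unfolding n_def
    by (meson max.cobounded1 max.cobounded2)+
  note x' = outer_inverse_power[OF k(2), of n] and y' = outer_inverse_power[OF l(2), of n]
  have "a ^ n * x ^ (n + 1) = x ^ (n + 1) * a ^ n"
    by (metis k(3) power_commuting_commutes)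
  then have x'': "x = x ^ (n + 1) * a ^ n"
    using x' by metis
  have y'': "a ^ (n + 1) * y = a ^ n"
    using y power_commuting_commutes[OF l(3), of "n + 1"] by metis
  have "x * (a * y) = x ^ (n + 1) * a ^ n * (a * y)"
    using x'' by metis
  also have "\<dots> = x ^ (n + 1) * (a ^ (n + 1) * y)"
    by (simp only: mult.assoc Suc_eq_plus1[symmetric] power_Suc2)
  also have "\<dots> = x"
    by (simp only: y'' x''[symmetric])
  finally show ?thesis
    by (simp only: absorb_common[OF x y'])
qed

lemma pc_invertible_imp_drazin_invertible:
  assumes "pc_invertible a"
  shows "drazin_invertible a"
proof -
  obtain x k where k: "x * a ^ (k + 1) = a ^ k" "a * x ^ 2 = x"
    using assms unfolding pc_invertible_def is_pc_inverse_def by blast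
  define n where "n = Suc k"
  have n: "x * a ^ (n + 1) = a ^ n"
    using left_inverse_power_mono[OF k(1), of n] by (simp only: n_def le_SucI order_refl)
  have an: "a ^ n * x ^ (n + 1) = x"
    using outer_inverse_power[OF k(2)] .
  have ax: "a * x ^ (n + 1) = x ^ n"
    using k(2) by (simp add: n_def power2_eq_square flip: mult.assoc)
  have pow: "x ^ j * a ^ (n + j) = a ^ n" for j
  proof (induction j)
    case (Suc j)
    have "x ^ Suc j * a ^ (n + Suc j) = x ^ j * (x * a ^ (n + j + 1))"
      by (simp only: power_Suc2 mult.assoc add_Suc_right Suc_eq_plus1[symmetric])
    also have "x * a ^ (n + j + 1) = a ^ (n + j)"
      using left_inverse_power_mono[OF n, of "n + j"] by (simp only: le_add1)
    finally show ?case
      using Suc by simp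
  qed simp
  define y where "y = x ^ (n + 1) * a ^ n"
  have ay: "a * y = x ^ n * a ^ n"
    by (simp only: y_def mult.assoc[symmetric] ax)
  have "y * a = x ^ n * (x * a ^ (n + 1))"
    by (simp only: y_def mult.assoc Suc_eq_plus1[symmetric] power_Suc2)
  then have ya: "y * a = x ^ n * a ^ n"
    by (simp only: n)
  have "y * a ^ (n + 1) = x ^ n * a ^ (n + n)"
    by (simp only: Suc_eq_plus1[symmetric] power_Suc mult.assoc[symmetric] ya power_add)
  then have 1: "y * a ^ (n + 1) = a ^ n"
    by (simp only: pow)
  have "a * y ^ 2 = x ^ n * (a ^ n * x ^ (n + 1)) * a ^ n"
    by (simp only: power2_eq_square mult.assoc[symmetric] ay) (simp only: y_def mult.assoc)
  then have 2: "a * y ^ 2 = y"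
    by (simp only: an) (simp only: y_def Suc_eq_plus1[symmetric] power_Suc2)
  show ?thesis
    unfolding drazin_invertible_def is_drazin_inverse_at_def
    using 1 2 ay ya by metis
qed

end

theory Submission
  imports Defs
begin

text \<open>
  Put \<open>x = pc a\<close>, \<open>p = a * x\<close>, \<open>c = a + b\<close>, \<open>u = 1 + x * b\<close>. The projection \<open>p\<close> commutes with \<open>b\<close>, and
  with respect to \<open>p\<close> the element \<open>a\<close> is block upper triangular with invertible corner
  \<open>\<alpha> = a * p\<close> and nilpotent corner \<open>(1 - p) * a\<close>. Hence \<open>c\<close> is upper triangular with corners
  \<open>c * p = \<alpha> * u\<close> and \<open>(1 - p) * c\<close>. The second corner is always p-core invertible, being a
  nilpotent perturbation of \<open>(1 - p) * b\<close>; the first is p-core invertible iff \<open>u\<close> is. The condition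
  on \<open>a\<^sup>\<pi>\<close> in (1) says that \<open>pc c\<close> is upper triangular too. The commutators
  \<open>p * c - c * p\<close> make the sum in (2) telescope to \<open>- u\<^sup>\<pi> * (p * c ^ m - c ^ m * p)\<close>, so (2) says that
  \<open>c ^ m\<close> maps into the sum of the ranges of its two corners, which is what an upper triangular
  pseudo core inverse requires.
\<close>

section \<open>Powers and commutators in monoids and rings\<close>

lemma mult_eq_assoc:
  fixes x y z w :: "'a::semigroup_mult"
  shows "x * y = w \<Longrightarrow> x * (y * z) = w * z"
  by (simp flip: mult.assoc)

lemma power_mult_commuting:
  fixes x y :: "'a::monoid_mult"
  assumes "x * y = y * x"
  shows "(x * y) ^ n = x ^ n * y ^ n"
proof (induction n)
  case (Suc n)
  have "y * x ^ n = x ^ n * y"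
    using power_commuting_commutes[OF assms, of n] by simp
  then have "x * (y * (x ^ n * y ^ n)) = x * (x ^ n * (y * y ^ n))"
    by (simp flip: mult.assoc)
  with Suc show ?case
    by (simp add: mult.assoc)
qed simp

text \<open>The hypothesis says that \<open>c\<close> preserves the range of \<open>e\<close>, so an
  \<open>e\<close> may be inserted before any power that ends in \<open>e\<close>. The third claim
  starts at \<open>Suc n\<close> because \<open>(c * e) ^ 0\<close> is \<open>1\<close>, not
  \<open>e\<close>; exponents \<open>Suc k\<close> further on have the same origin.\<close>

lemma power_corner_right:
  fixes c e :: "'a::monoid_mult"
  assumes "e * e = e" "c * e = e * c * e"
  shows "e * c ^ n * e = c ^ n * e" "(c * e) ^ n * e = c ^ n * e"
    "(c * e) ^ Suc n = c ^ Suc n * e"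
proof -
  show 1: "e * c ^ n * e = c ^ n * e" for n
  proof (induction n)
    case (Suc n)
    have "e * c ^ Suc n * e = e * c * (c ^ n * e)"
      by (simp add: mult.assoc)
    also have "\<dots> = e * c * (e * c ^ n * e)"
      by (simp only: Suc)
    also have "\<dots> = c * (e * c ^ n * e)"
      by (simp only: mult.assoc[symmetric] assms(2)[symmetric])
    finally show ?case
      by (simp only: Suc) (simp add: mult.assoc)
  qed (simp add: assms)
  show 2: "(c * e) ^ n * e = c ^ n * e" for n
  proof (induction n)
    case (Suc n)
    have "(c * e) ^ Suc n * e = c * (e * (c ^ n * e))"
      by (simp add: mult.assoc Suc)
    then show ?case
      using 1[of n] by (simp add: mult.assoc)
  qed simp
  have "(c * e) ^ Suc n = (c * e) ^ Suc n * e"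
    by (simp only: power_Suc2 mult.assoc assms(1))
  then show "(c * e) ^ Suc n = c ^ Suc n * e"
    by (simp only: 2)
qed

text \<open>The mirror image, for \<open>c\<close> preserving the kernel of \<open>e\<close>. A
  typical case is \<open>e = 1 - p\<close> when \<open>c\<close> preserves the range of
  \<open>p\<close>.\<close>

lemma power_corner_left:
  fixes c e :: "'a::monoid_mult"
  assumes "e * e = e" "e * c = e * c * e"
  shows "(e * c) ^ Suc n = e * c ^ Suc n"
proof (induction n)
  case (Suc n)
  have "(e * c) ^ Suc (Suc n) = e * c * (e * c ^ Suc n)"
    by (simp only: power_Suc[of "e * c" "Suc n"] Suc)
  also have "\<dots> = e * c * c ^ Suc n"
    by (metis assms(2) mult.assoc)
  finally show ?case
    by (simp add: mult.assoc)
qed simp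

text \<open>The \<open>i\<close>-th summand is
  \<open>c ^ (i - 1) * p * c ^ (m - i + 1) - c ^ i * p * c ^ (m - i)\<close>, so the sum
  telescopes.\<close>

lemma sum_powers_commutator:
  fixes c p :: "'a::{ring, monoid_mult}"
  shows "(\<Sum>i = 1..m. c ^ (i - 1) * (p * c - c * p) * c ^ (m - i)) = p * c ^ m - c ^ m * p"
proof (induction m)
  case (Suc m)
  have "c ^ (i - 1) * (p * c - c * p) * c ^ (Suc m - i)
      = c ^ (i - 1) * (p * c - c * p) * c ^ (m - i) * c" if "i \<in> {1..m}" for i
    using that by (simp add: Suc_diff_le mult.assoc power_commutes)
  then have "(\<Sum>i = 1..m. c ^ (i - 1) * (p * c - c * p) * c ^ (Suc m - i))
      = (p * c ^ m - c ^ m * p) * c"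
    by (simp add: Suc.IH[symmetric] sum_distrib_right)
  then have "(\<Sum>i = 1..Suc m. c ^ (i - 1) * (p * c - c * p) * c ^ (Suc m - i))
      = (p * c ^ m - c ^ m * p) * c + c ^ m * (p * c - c * p)"
    by simp
  also have "\<dots> = p * c ^ Suc m - c ^ Suc m * p"
    by (simp only: power_Suc2) (simp add: algebra_simps)
  finally show ?case .
qed simp

lemma nilpotent_one_plus_inverse:
  fixes d :: "'a::{ring, monoid_mult}"
  assumes "d ^ N = 0"
  obtains g where "(1 + d) * g = 1" "g * (1 + d) = 1"
proof -
  \<comment> \<open>The geometric series for the inverse, finite because \<open>d\<close> is
    nilpotent.\<close>
  define g where "g = (\<Sum>i<N. (- d) ^ i)"
  have pow: "(- d) ^ n = d ^ n \<or> (- d) ^ n = - (d ^ n)" for n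
    by (induction n) auto
  have comm: "(- d) ^ n * d = d * (- d) ^ n" for n
    by (rule power_commuting_commutes) simp
  have "(1 + d) * (\<Sum>i<n. (- d) ^ i) = 1 - (- d) ^ n"
    "(\<Sum>i<n. (- d) ^ i) * (1 + d) = 1 - (- d) ^ n" for n
    by (induction n) (simp_all add: algebra_simps comm)
  then show ?thesis
    using that[of g] pow[of N] assms by (auto simp: g_def)
qed

text \<open>Modulo \<open>n\<close> only \<open>b ^ k\<close> survives. The cofactor
  \<open>r\<close> commutes with both summands, so powers of \<open>(b + n) ^ k\<close> can be
  treated one factor at a time.\<close>

lemma add_power_commuting_expand:
  fixes b n :: "'a::{ring, monoid_mult}"
  assumes "n * b = b * n"
  obtains r where "(b + n) ^ k = b ^ k + n * r" "r * b = b * r" "r * n = n * r"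
proof -
  have "\<exists>r. (b + n) ^ k = b ^ k + n * r \<and> r * b = b * r \<and> r * n = n * r"
  proof (induction k)
    case 0
    show ?case by (rule exI[of _ 0]) simp
  next
    case (Suc k)
    then obtain r where r: "(b + n) ^ k = b ^ k + n * r" "r * b = b * r" "r * n = n * r"
      by blast
    note comm = assms r(2,3) power_commutes[of b k] power_commuting_commutes[OF assms[symmetric], of k]
    show ?case
    proof (intro exI[of _ "b ^ k + r * (b + n)"] conjI)
      show "(b + n) ^ Suc k = b ^ Suc k + n * (b ^ k + r * (b + n))"
        unfolding power_Suc2 r(1)
        by (simp add: algebra_simps comm)
      show "(b ^ k + r * (b + n)) * b = b * (b ^ k + r * (b + n))"
        by (simp add: algebra_simps comm comm[THEN mult_eq_assoc])
      show "(b ^ k + r * (b + n)) * n = n * (b ^ k + r * (b + n))"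
        by (simp add: algebra_simps comm comm[THEN mult_eq_assoc])
    qed
  qed
  with that show ?thesis by blast
qed

section \<open>The involution\<close>

lemma star_diff: "star (x - y) = star x - star (y::'a::banach_star_algebra)"
  using star_add[of "x - y" y] by (simp add: algebra_simps)

lemma star_one: "star (1::'a::banach_star_algebra) = 1"
  using star_mult[of "star (1::'a)" 1] by (simp add: star_star)

section \<open>Pseudo core inverses\<close>

text \<open>A criterion phrased through the projection \<open>c * y\<close>. In applications this
  product is computed first, and the conditions then concern a known projection.\<close>

lemma is_pc_inverseI:
  fixes c y :: "'a::banach_star_algebra"
  assumes "star (c * y) = c * y" "c * y * y = y" "y * c * (c * y) = c * y" "c * y * c ^ n = c ^ n"
  shows "is_pc_inverse c y"
  unfolding is_pc_inverse_def
proof (intro exI[of _ n] conjI)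
  have "y * c ^ (n + 1) = y * c * (c * y * c ^ n)"
    by (simp only: assms(4)) (simp add: mult.assoc)
  also have "\<dots> = y * c * (c * y) * c ^ n"
    by (simp only: mult.assoc)
  finally show "y * c ^ (n + 1) = c ^ n"
    by (simp only: assms(3,4))
qed (use assms in \<open>simp_all add: power2_eq_square mult.assoc\<close>)

text \<open>The self-adjoint idempotent \<open>c * y\<close> factors through every power of
  \<open>c\<close> and fixes all high ones: it projects onto their common range, where
  \<open>y\<close> inverts \<open>c\<close>.\<close>

lemma is_pc_inverseD:
  fixes c y :: "'a::banach_star_algebra"
  assumes "is_pc_inverse c y"
  shows "star (c * y) = c * y" "c * y * y = y" "y * c * (c * y) = c * y" "y * (c * y) = y"
    "c ^ n * y ^ (n + 1) = y" "c ^ (n + 1) * y ^ (n + 1) = c * y"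
    "\<exists>k. \<forall>n\<ge>k. c * y * c ^ n = c ^ n \<and> y * c ^ (n + 1) = c ^ n"
proof -
  obtain k where k: "y * c ^ (k + 1) = c ^ k" "c * y ^ 2 = y" "star (c * y) = c * y"
    using assms unfolding is_pc_inverse_def by blast
  show "star (c * y) = c * y" by (fact k(3))
  show 2: "c * y * y = y"
    using k(2) by (simp add: power2_eq_square mult.assoc)
  show pw: "c ^ n * y ^ (n + 1) = y" for n
    by (rule outer_inverse_power[OF k(2)])
  show pq: "c ^ (n + 1) * y ^ (n + 1) = c * y" for n
  proof -
    have "c ^ (n + 1) * y ^ (n + 1) = c * (c ^ n * y ^ (n + 1))"
      by (simp add: mult.assoc)
    then show ?thesis by (simp only: pw)
  qed
  show "y * (c * y) = y"
    using absorb_common[OF k(1) pw] .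
  have yc: "y * c ^ (n + 1) = c ^ n" if "n \<ge> k" for n
    by (rule left_inverse_power_mono[OF k(1) that])
  have "y * c * (c * y) = y * c * (c ^ (k + 1) * y ^ (k + 1))"
    by (simp only: pq)
  also have "\<dots> = y * c ^ (Suc k + 1) * y ^ (k + 1)"
    by (simp add: mult.assoc)
  also have "\<dots> = c ^ (k + 1) * y ^ (k + 1)"
    using yc[of "Suc k"] by simp
  finally show "y * c * (c * y) = c * y"
    by (simp only: pq)
  have "c * y * c ^ n = c ^ n" if "n \<ge> k" for n
  proof -
    have "c * y * c ^ n = c * y * y * c ^ (n + 1)"
      by (simp only: yc[OF that, symmetric] mult.assoc)
    then show ?thesis
      by (simp only: 2 yc[OF that])
  qed
  with yc show "\<exists>k. \<forall>n\<ge>k. c * y * c ^ n = c ^ n \<and> y * c ^ (n + 1) = c ^ n"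
    by blast
qed

lemma is_pc_inverse_pc: "pc_invertible c \<Longrightarrow> is_pc_inverse c (pc c)"
  unfolding pc_invertible_def pc_def by (metis is_pc_inverse_unique theI)

lemma pc_eq: "is_pc_inverse c y \<Longrightarrow> pc c = y"
  using is_pc_inverse_pc is_pc_inverse_unique pc_invertible_def by blast

text \<open>An element commuting with \<open>b\<close> preserves the range of \<open>b * B\<close>; since its adjoint does so
  too, it commutes with the projection \<open>b * B\<close>.\<close>

lemma is_pc_inverse_commute:
  fixes b B z :: "'a::banach_star_algebra"
  assumes B: "is_pc_inverse b B" and z: "z * b = b * z" "star z * b = b * star z"
  shows "z * (b * B) = b * B * z" "z * B = B * z"
proof -
  note D = is_pc_inverseD[OF B]
  obtain k where k: "\<And>n. n \<ge> k \<Longrightarrow> b * B * b ^ n = b ^ n"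
      "\<And>n. n \<ge> k \<Longrightarrow> B * b ^ (n + 1) = b ^ n"
    using D(7) by blast
  have inv: "b * B * (w * (b * B)) = w * (b * B)" if "w * b = b * w" for w
  proof -
    have "w * (b * B) = w * b ^ (k + 1) * B ^ (k + 1)"
      by (simp only: D(6) mult.assoc)
    also have "w * b ^ (k + 1) = b ^ (k + 1) * w"
      using power_commuting_commutes[OF that[symmetric]] by metis
    finally have w: "w * (b * B) = b ^ (k + 1) * (w * B ^ (k + 1))"
      by (simp only: mult.assoc)
    show ?thesis
      unfolding w using k(1)[of "k + 1"] by (simp only: mult.assoc[symmetric] le_add1)
  qed
  have "star (b * B * (star z * (b * B))) = star (star z * (b * B))"
    using inv[OF z(2)] by (rule arg_cong)
  then have "b * B * z * (b * B) = b * B * z"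
    by (simp only: star_mult[of _ "b * B"] star_mult[of "b * B"] D(1) star_star)
  with inv[OF z(1)] show zq: "z * (b * B) = b * B * z"
    by (simp only: mult.assoc)
  have zp: "z * b ^ n = b ^ n * z" for n
    using power_commuting_commutes[OF z(1)[symmetric]] by metis
  \<comment> \<open>With \<open>B\<close> written as \<open>B * (b * B)\<close>, \<open>z\<close>
    first passes the projection and then only powers of \<open>b\<close>, while the leading
    \<open>B\<close> cancels one factor \<open>b\<close>.\<close>
  have "B * z = B * (b * B * z)"
    by (simp only: mult.assoc[symmetric]) (simp only: mult.assoc[of B b] D(4))
  also have "\<dots> = B * (z * (b ^ (k + 1) * B ^ (k + 1)))"
    by (simp only: zq[symmetric] D(6))
  also have "\<dots> = B * b ^ (k + 1) * z * B ^ (k + 1)"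
    by (simp only: mult.assoc[symmetric]) (simp only: mult.assoc zp)
  also have "\<dots> = z * (b ^ k * B ^ (k + 1))"
    using k(2)[of k] by (simp only: zp mult.assoc[symmetric]) 
  finally show "z * B = B * z"
    by (simp only: D(5))
qed

text \<open>The self-adjoint \<open>e\<close> commutes with \<open>b\<close>, hence also with
  \<open>B\<close> and \<open>b * B\<close>, so compressing by \<open>e\<close> respects all the
  relations.\<close>

lemma is_pc_inverse_corner:
  fixes b B e :: "'a::banach_star_algebra"
  assumes B: "is_pc_inverse b B" and e: "star e = e" "e * e = e" "e * b = b * e"
  shows "is_pc_inverse (e * b) (e * B)" "e * b * (e * B) = e * (b * B)"
proof -
  note D = is_pc_inverseD[OF B]
  have eq: "e * (b * B) = b * B * e" and eB: "e * B = B * e"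
    using is_pc_inverse_commute[OF B e(3)] e by auto
  show prod: "e * b * (e * B) = e * (b * B)"
    by (simp only: e(3)) (simp only: mult.assoc mult_eq_assoc[OF e(2)], simp only: eB eq mult.assoc)
  obtain k where k: "\<And>n. n \<ge> k \<Longrightarrow> b * B * b ^ n = b ^ n"
    using D(7) by blast
  show "is_pc_inverse (e * b) (e * B)"
  proof (rule is_pc_inverseI[where n = "Suc k"])
    show "star (e * b * (e * B)) = e * b * (e * B)"
      by (simp only: prod star_mult[of e] D(1) e(1)) (simp only: eq)
    show "e * b * (e * B) * (e * B) = e * B"
      by (simp only: prod) (metis D(2) e(2) eB mult.assoc)
    have "e * B * (e * b) * (e * (b * B)) = B * b * (b * B) * e"
      by (simp only: eB eq e(3)) (simp add: mult.assoc e(2) mult_eq_assoc[OF e(2)] e(3) mult_eq_assoc[OF e(3)] eB eB[THEN mult_eq_assoc])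
    then show "e * B * (e * b) * (e * b * (e * B)) = e * b * (e * B)"
      by (simp only: prod D(3)) (simp only: eq)
    have "e * b = e * b * e"
      by (metis e(2,3) mult.assoc)
    then have "(e * b) ^ Suc k = e * b ^ Suc k"
      by (rule power_corner_left[OF e(2)])
    then show "e * b * (e * B) * (e * b) ^ Suc k = (e * b) ^ Suc k"
      using k[of "Suc k"] by (simp only: prod eq) (metis e(2) eq le_add2 mult.assoc plus_1_eq_Suc)
  qed
qed

text \<open>On the range of \<open>s\<close> the factor \<open>y\<close> is invertible with inverse
  \<open>\<alpha>\<close>, so multiplying \<open>s\<close> by \<open>y\<close> leaves the projection
  \<open>s * S\<close> unchanged. This serves to pass between \<open>c * p\<close> and
  \<open>p * u\<close> in both directions.\<close>

lemma is_pc_inverse_mult_commuting: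
  fixes s S \<alpha> y :: "'a::banach_star_algebra"
  assumes S: "is_pc_inverse s S" and comm: "\<alpha> * s = s * \<alpha>" "y * s = s * y" "\<alpha> * y = y * \<alpha>" and ys: "y * \<alpha> * s = s"
  shows "is_pc_inverse (y * s) (\<alpha> * S)" "y * s * (\<alpha> * S) = s * S"
proof -
  note D = is_pc_inverseD[OF S]
  obtain k where k: "\<And>n. n \<ge> k \<Longrightarrow> s * S * s ^ n = s ^ n" "\<And>n. n \<ge> k \<Longrightarrow> S * s ^ (n + 1) = s ^ n"
    using D(7) by blast
  have "y * s * (\<alpha> * S) = y * \<alpha> * s * S"
    by (simp only: mult.assoc mult_eq_assoc[OF comm(1)])
  then show prod: "y * s * (\<alpha> * S) = s * S"
    by (simp only: ys)
  have sp: "\<alpha> * s ^ n = s ^ n * \<alpha>" "y ^ m * s ^ n = s ^ n * y ^ m" for n m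
    using power_commuting_commutes comm by metis+
  have "s * S * (\<alpha> * S) = s * S * (\<alpha> * s ^ k * S ^ (k + 1))"
    by (simp only: D(5) mult.assoc)
  also have "\<dots> = s * S * s ^ k * \<alpha> * S ^ (k + 1)"
    by (simp only: sp(1)) (simp only: mult.assoc)
  also have "\<dots> = \<alpha> * (s ^ k * S ^ (k + 1))"
    by (simp only: k(1)[OF order_refl] sp(1)[symmetric]) (simp only: mult.assoc)
  finally have 2: "s * S * (\<alpha> * S) = \<alpha> * S"
    by (simp only: D(5))
  have "\<alpha> * S * (y * s) ^ (k + 1 + 1) = \<alpha> * (S * s ^ (k + 1 + 1)) * y ^ (k + 1 + 1)"
    by (simp only: power_mult_commuting[OF comm(2)] sp(2) mult.assoc)
  also have "\<dots> = \<alpha> * s ^ (k + 1) * y ^ (k + 1 + 1)"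
    using k(2)[of "k + 1"] by (simp only: le_add1)
  also have "\<dots> = y ^ (k + 1) * (y * \<alpha> * s) * s ^ k"
  proof -
    have "\<alpha> * s ^ (k + 1) * y ^ (k + 1 + 1) = s ^ (k + 1) * (\<alpha> * y ^ (k + 1 + 1))"
      by (simp only: sp(1) mult.assoc)
    also have "\<dots> = s ^ (k + 1) * (y ^ (k + 1 + 1) * \<alpha>)"
      by (simp only: power_commuting_commutes[OF comm(3)[symmetric]])
    also have "\<dots> = y ^ (k + 1 + 1) * s ^ (k + 1) * \<alpha>"
      by (simp only: mult.assoc[symmetric] sp(2))
    also have "\<dots> = y ^ (k + 1 + 1) * \<alpha> * s ^ (k + 1)"
      by (simp only: mult.assoc sp(1))
    also have "\<dots> = y ^ (k + 1) * (y * \<alpha> * s) * s ^ k"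
      by (simp add: mult.assoc mult_eq_assoc[OF power_commutes])
    finally show ?thesis .
  qed
  also have "\<dots> = (y * s) ^ (k + 1)"
    by (simp only: ys power_mult_commuting[OF comm(2)]) (simp add: mult.assoc)
  finally have 1: "\<alpha> * S * (y * s) ^ (k + 1 + 1) = (y * s) ^ (k + 1)" .
  show "is_pc_inverse (y * s) (\<alpha> * S)"
    unfolding is_pc_inverse_def power2_eq_square
    by (rule exI[of _ "k + 1"], intro conjI 1)
      (simp_all only: prod D(1) mult.assoc[symmetric, of "y * s" "\<alpha> * S"] 2)
qed

text \<open>The sum keeps the projection \<open>q = b * B\<close> of \<open>b\<close>. On its range
  \<open>b + n\<close> is \<open>b\<close> times the invertible \<open>1 + n * B\<close>, since
  \<open>n * B\<close> is nilpotent; \<open>1 - q\<close> kills a high power of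
  \<open>b + n\<close>.\<close>

lemma pc_invertible_add_nilpotent:
  fixes b n :: "'a::banach_star_algebra"
  assumes b: "pc_invertible b" and N: "n ^ N = 0"
    and comm: "n * b = b * n" "star n * b = b * star n"
  shows "pc_invertible (b + n)"
proof -
  obtain B where B: "is_pc_inverse b B"
    using b pc_invertible_def by blast
  note D = is_pc_inverseD[OF B]
  define q where "q = b * B"
  have nq: "n * q = q * n" and nB: "n * B = B * n"
    using is_pc_inverse_commute[OF B comm] by (auto simp: q_def)
  have qB: "q * B = B" and Bbq: "B * (b * q) = q"
    using D(2,3) by (auto simp: q_def mult.assoc)
  have "(n * B) ^ N = 0"
    by (simp add: power_mult_commuting[OF nB] N)
  then obtain g where g: "(1 + n * B) * g = 1" "g * (1 + n * B) = 1"
    by (rule nilpotent_one_plus_inverse)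
  have "B * (1 + n * B) = (1 + n * B) * B"
    by (simp add: algebra_simps) (simp add: nB mult_eq_assoc[OF nB] mult.assoc)
  then have gB: "g * B = B * g"
    by (metis g mult.assoc mult_1_left mult_1_right)
  have qd: "q * (n * B) = n * B"
    by (simp only: mult.assoc[symmetric] nq[symmetric]) (simp only: mult.assoc qB)
  have prod: "(b + n) * (B * g) = q"
  proof -
    have "(b + n) * (B * g) = q * g + q * (n * B) * g"
      by (simp only: qd) (simp add: q_def algebra_simps)
    also have "\<dots> = q * ((1 + n * B) * g)"
      by (simp add: algebra_simps)
    finally show ?thesis by (simp add: g)
  qed
  obtain k where k: "\<And>n. n \<ge> k \<Longrightarrow> q * b ^ n = b ^ n"
    using D(7) unfolding q_def by blast
  obtain r where r: "(b + n) ^ k = b ^ k + n * r" "r * b = b * r" "r * n = n * r"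
    using add_power_commuting_expand[OF comm(1)] .
  have cr: "(b + n) * r = r * (b + n)"
    by (simp add: algebra_simps r)
  \<comment> \<open>As \<open>1 - q\<close> kills \<open>b ^ k\<close>, each block
    \<open>(b + n) ^ k\<close> releases one factor \<open>n\<close>; after \<open>N\<close> blocks
    nothing is left.\<close>
  have "(1 - q) * (b + n) ^ (k * j) = n ^ j * (1 - q) * r ^ j" for j
  proof (induction j)
    case (Suc j)
    have "(1 - q) * (b + n) ^ (k * Suc j) = n ^ j * (1 - q) * r ^ j * (b + n) ^ k"
      using Suc by (simp add: power_add add.commute[of k] flip: mult.assoc)
    also have "r ^ j * (b + n) ^ k = (b + n) ^ k * r ^ j"
      using power_commuting_commutes cr by metis
    then have "n ^ j * (1 - q) * r ^ j * (b + n) ^ k = n ^ j * ((1 - q) * (b + n) ^ k) * r ^ j"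
      by (simp add: mult.assoc)
    also have "(1 - q) * (b + n) ^ k = n * (1 - q) * r"
      using k[of k] by (simp add: r algebra_simps nq mult_eq_assoc[OF nq])
    finally show ?case
      by (simp add: mult.assoc power_commutes mult_eq_assoc[OF power_commutes])
  qed simp
  from this[of N] have nil: "q * (b + n) ^ (k * N) = (b + n) ^ (k * N)"
    by (simp add: N algebra_simps)
  have "is_pc_inverse (b + n) (B * g)"
  proof (rule is_pc_inverseI[where n = "k * N"], unfold prod)
    show "star q = q" unfolding q_def by (fact D(1))
    show "q * (B * g) = B * g" by (simp only: mult.assoc[symmetric] qB)
    have "B * n * q = n * B * q"
      by (simp only: nB)
    then have "B * g * (b + n) * q = g * (1 + n * B) * q"
      by (simp only: gB[symmetric]) (simp add: algebra_simps Bbq)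
    then show "B * g * (b + n) * q = q" by (simp add: g)
  qed (rule nil)
  then show ?thesis
    unfolding pc_invertible_def by blast
qed

section \<open>Drazin inverses\<close>

text \<open>The idempotent \<open>u * d\<close> equals both \<open>u ^ Suc n * d ^ Suc n\<close> and
  \<open>d ^ Suc n * u ^ Suc n\<close>. Moving \<open>z\<close> past the powers of \<open>u\<close>
  shows that \<open>z\<close> preserves its range and its kernel, hence commutes with it.\<close>

lemma spectral_idem_props:
  fixes u :: "'a::banach_star_algebra"
  assumes "drazin_invertible u"
  shows "m \<ge> drazin_index u \<Longrightarrow> spectral_idem u * u ^ m = 0"
    "\<exists>y. 1 - spectral_idem u = u ^ n * y" 
    "z * u = u * z \<Longrightarrow> z * spectral_idem u = spectral_idem u * z"
proof -
  obtain x l where x: "is_drazin_inverse_at l u x"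
    using assms drazin_invertible_def by blast
  have "\<exists>d. is_drazin_inverse_at (drazin_index u) u d"
    unfolding drazin_index_def by (rule LeastI[of _ l]) (use x in blast)
  then obtain d where d: "is_drazin_inverse_at (drazin_index u) u d" by blast
  then have "drazin u = d"
    unfolding drazin_def using is_drazin_inverse_at_unique by blast
  define k where "k = drazin_index u"
  have D: "d * u ^ (k + 1) = u ^ k" "u * d ^ 2 = d" "u * d = d * u"
    using d by (simp_all only: is_drazin_inverse_at_def k_def)
  have W: "spectral_idem u = 1 - u * d"
    by (simp add: spectral_idem_def \<open>drazin u = d\<close>)
  have ud: "u * d * u ^ m = u ^ m" if "m \<ge> k" for m
    using left_inverse_power_mono[OF D(1) that] by (simp add: D(3) mult.assoc)
  then show "spectral_idem u * u ^ m = 0" if "m \<ge> drazin_index u" for m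
    using that by (simp add: W k_def algebra_simps)
  have pow: "u ^ Suc n * d ^ Suc n = u * d" for n
    using outer_inverse_power[OF D(2), of n] by (simp add: mult.assoc)
  have pow': "d ^ Suc n * u ^ Suc n = u * d" for n
    using pow[of n] by (metis D(3) power_commuting_commutes)
  have "1 - spectral_idem u = u ^ n * (u * d ^ Suc n)"
    using pow[of n] by (simp add: W mult.assoc mult_eq_assoc[OF power_commutes])
  then show "\<exists>y. 1 - spectral_idem u = u ^ n * y"
    by blast
  assume z: "z * u = u * z"
  have zu: "z * u ^ m = u ^ m * z" for m
    using power_commuting_commutes[OF z[symmetric]] by metis
  have "z * (u * d) = u ^ Suc k * (z * d ^ Suc k)"
    by (metis mult.assoc pow zu)
  then have 1: "u * d * (z * (u * d)) = z * (u * d)"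
    using ud[of "Suc k"] by (metis le_add2 mult.assoc plus_1_eq_Suc)
  have ud': "u ^ Suc k * (u * d) = u ^ Suc k"
    using ud[of "Suc k"] by (metis D(3) le_add2 mult.assoc plus_1_eq_Suc power_commutes power_commuting_commutes)
  have "u * d * z = d ^ Suc k * z * u ^ Suc k"
    by (metis mult.assoc pow' zu)
  then have 2: "u * d * z * (u * d) = u * d * z"
    using ud' by (metis mult.assoc)
  show "z * spectral_idem u = spectral_idem u * z"
    using 1 2 by (simp add: W algebra_simps)
qed

text \<open>The idempotents \<open>u * v\<close> and \<open>1 - spectral_idem u\<close> both have
  the range of the high powers of \<open>u\<close>, so each absorbs the other from the left.\<close>

lemma spectral_idem_pc:
  fixes u v :: "'a::banach_star_algebra"
  assumes v: "is_pc_inverse u v"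
  shows "spectral_idem u * (u * v) = 0" "u * v * spectral_idem u = spectral_idem u - (1 - u * v)"
proof -
  have dr: "drazin_invertible u"
    using v pc_invertible_def pc_invertible_imp_drazin_invertible by blast
  note D = is_pc_inverseD[OF v]
  note W = spectral_idem_props[OF dr]
  have "spectral_idem u * (u * v) = spectral_idem u * u ^ (drazin_index u + 1) * v ^ (drazin_index u + 1)"
    by (simp only: D(6) mult.assoc)
  then show "spectral_idem u * (u * v) = 0"
    by (subst (asm) W(1)) simp_all
  obtain k where k: "u * v * u ^ k = u ^ k"
    using D(7) by blast
  obtain y where "1 - spectral_idem u = u ^ k * y"
    using W(2) by blast
  then have "u * v * (1 - spectral_idem u) = 1 - spectral_idem u"
    by (metis k mult.assoc)
  then show "u * v * spectral_idem u = spectral_idem u - (1 - u * v)"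
    by (simp add: algebra_simps)
qed

section \<open>Block triangular elements\<close>

text \<open>Both \<open>c\<close> and \<open>y\<close> preserve the range of \<open>p\<close>, hence
  so does \<open>c * y\<close>; being self-adjoint, it commutes with \<open>p\<close>.\<close>

lemma is_pc_inverse_upper_block:
  fixes c y p :: "'a::banach_star_algebra"
  assumes y: "is_pc_inverse c y" and p: "star p = p" "p * p = p"
    and cp: "c * p = p * c * p" and yp: "y * p = p * y * p"
  shows "is_pc_inverse (c * p) (y * p)" "c * p * (y * p) = c * y * p" "c * y * p = p * (c * y)"
proof -
  note D = is_pc_inverseD[OF y]
  have pyp: "p * (y * p) = y * p" and pcp: "p * (c * p) = c * p"
    using yp cp by (simp_all add: mult.assoc)
  show prod: "c * p * (y * p) = c * y * p"
    by (simp add: mult.assoc pyp)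
  have pqp: "p * (c * y) * p = c * y * p"
    by (metis cp mult.assoc pyp)
  then have "star (p * (c * y) * p) = star (c * y * p)" by simp
  moreover have "star (p * (c * y) * p) = p * (c * y) * p"
    by (simp only: star_mult[of "p * (c * y)" p] star_mult[of p "c * y"] D(1) p(1)) (simp only: mult.assoc)
  moreover have "star (c * y * p) = p * (c * y)"
    by (simp only: star_mult[of "c * y" p] D(1) p(1))
  ultimately have "p * (c * y) * p = p * (c * y)" by simp
  with pqp show comm: "c * y * p = p * (c * y)" by simp
  obtain k where k: "\<And>n. n \<ge> k \<Longrightarrow> c * y * c ^ n = c ^ n"
    using D(7) by blast
  show "is_pc_inverse (c * p) (y * p)"
  proof (rule is_pc_inverseI[where n = "Suc k"], unfold prod)
    show "star (c * y * p) = c * y * p"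
      by (simp only: star_mult[of "c * y" p] D(1) p(1)) (simp only: comm)
    show "c * y * p * (y * p) = y * p"
      by (metis D(2) mult.assoc pyp)
    have "y * p * (c * p) * (c * y * p) = y * c * (c * y) * p"
      by (metis comm mult.assoc p(2) pcp)
    then show "y * p * (c * p) * (c * y * p) = c * y * p"
      by (simp only: D(3))
    show "c * y * p * (c * p) ^ Suc k = (c * p) ^ Suc k"
      using k[of "Suc k"] power_corner_right[OF p(2) cp]
      by (metis le_add2 mult.assoc plus_1_eq_Suc)
  qed
qed

text \<open>The candidate is the inverse formula for an upper triangular 2 by 2 block matrix. The
  hypothesis \<open>range\<close> makes the off-diagonal terms cancel in its product with
  \<open>c\<close>, leaving the block diagonal projection \<open>q + r\<close>.\<close>

lemma is_pc_inverse_triangular: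
  fixes c S T p :: "'a::banach_star_algebra"
  assumes p: "star p = p" "p * p = p" and cp: "c * p = p * c * p"
    and S: "is_pc_inverse (c * p) S" and T: "is_pc_inverse ((1 - p) * c) T"
    and range: "\<And>n. n \<ge> N \<Longrightarrow> c * p * S * (p * c ^ n) = p * c ^ n"
  shows "is_pc_inverse c (S + T - S * c * T)" "p * S = S" "T * p = 0"
proof -
  define e s t where "e = 1 - p" and "s = c * p" and "t = e * c"
  define q r where "q = s * S" and "r = t * T"
  note DS = is_pc_inverseD[OF S, folded s_def, folded q_def]
  note DT = is_pc_inverseD[OF T, folded e_def, folded t_def, folded r_def]
  have e: "e * e = e" "e * p = 0" "p * e = 0"
    by (simp_all add: e_def algebra_simps p)
  have pe: "p * z + e * z = z" for z
    by (simp add: e_def algebra_simps)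
  have ep: "z * p + z * e = z" for z
    by (simp add: e_def algebra_simps)
  have sp: "p * s = s" "s * p = s"
    using cp by (simp_all add: s_def mult.assoc p)
  have ecp: "e * c * p = 0"
    using cp by (simp add: e_def algebra_simps)
  have t: "e * t = t" "t * e = t"
    using ep[of "e * c"] by (simp_all add: t_def ecp flip: mult.assoc) (simp add: e)
  have pS: "p * S = S"
    by (metis DS(2) mult.assoc q_def sp(1))
  have qp: "p * q = q" "q * p = q"
  proof -
    show "p * q = q" by (metis mult.assoc q_def sp(1))
    then show "q * p = q" using DS(1) p(1) star_mult by metis
  qed
  have Sp: "S * p = S"
    by (metis DS(4) mult.assoc qp(2))
  have eT: "e * T = T"
    by (metis DT(2) mult.assoc r_def t(1))
  have re: "e * r = r" "r * e = r"
  proof -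
    show "e * r = r" by (metis mult.assoc r_def t(1))
    moreover have "star e = e" by (simp add: e_def star_diff star_one p)
    ultimately show "r * e = r" using DT(1) star_mult by metis
  qed
  have Te: "T * e = T"
    by (metis DT(4) mult.assoc re(2))
  show "p * S = S" by (fact pS)
  show "T * p = 0" by (metis Te e(2) mult.assoc mult_zero_right)
  have orth: "p * T = 0" "T * p = 0" "e * S = 0" "S * e = 0" "q * e = 0" "e * q = 0"
      "r * p = 0" "p * r = 0"
    by (metis Te eT pS Sp qp re e mult.assoc mult_zero_right mult_zero_left)+
  obtain k where k: "\<And>n. n \<ge> k \<Longrightarrow> r * t ^ n = t ^ n"
    using DT(7) by blast
  have tn: "t ^ Suc n = e * c ^ Suc n" for n
    unfolding t_def by (rule power_corner_left[OF e(1)]) (metis t t_def)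
  have qsq: "q * (s * q) = s * q"
  proof -
    obtain j where j: "\<And>n. n \<ge> j \<Longrightarrow> q * s ^ n = s ^ n"
      using DS(7) by blast
    have "s * q = s ^ Suc (Suc j) * S ^ Suc j"
      using DS(6)[of j] by (simp add: mult.assoc)
    then show ?thesis using j[of "Suc (Suc j)"] by (metis le_SucI mult.assoc order_refl)
  qed
  text \<open>The off-diagonal block of \<open>c\<close> maps the range of \<open>r\<close> into the range of \<open>q\<close>: the relation
    \<open>q * p * c ^ n = p * c ^ n\<close> holds for two consecutive powers and \<open>s\<close> preserves the range
    of \<open>q\<close>.\<close>
  have pcT: "q * (c * T) = p * (c * T)"
  proof -
    define n where "n = Suc N"
    have R: "q * (p * c ^ n) = p * c ^ n" "q * (p * c ^ Suc n) = p * c ^ Suc n"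
      using range[of n] range[of "Suc n"] by (simp_all only: n_def q_def s_def le_SucI order_refl)
    have "p * c * t ^ n = p * c ^ Suc n - p * c * p * c ^ n"
      unfolding n_def tn by (simp add: e_def algebra_simps)
    then have "p * c * t ^ n = p * c ^ Suc n - s * (p * c ^ n)"
      by (metis cp mult.assoc s_def sp(2))
    moreover have "q * (s * (p * c ^ n)) = s * (p * c ^ n)"
      by (metis R(1) mult.assoc qsq)
    ultimately have "q * (p * c * t ^ n) = p * c * t ^ n"
      by (simp only: R(2) right_diff_distrib)
    then have "q * (p * c * (t ^ n * T ^ (n + 1))) = p * c * (t ^ n * T ^ (n + 1))"
      by (simp only: mult.assoc[symmetric])
    then have "q * (p * c * T) = p * c * T"
      by (simp only: DT(5))
    then show ?thesis
      by (metis mult.assoc qp(2))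
  qed
  let ?y = "S + T - S * c * T"
  have cS: "c * S = q"
    by (metis mult.assoc pS q_def s_def)
  have cT: "c * T = p * (c * T) + r"
    by (metis mult.assoc pe r_def t_def)
  have prod: "c * ?y = q + r"
  proof -
    have "c * ?y = c * S + c * T - c * S * (c * T)"
      by (simp add: algebra_simps)
    also have "\<dots> = q + (p * (c * T) + r) - q * (c * T)"
      using cS cT by simp
    finally show ?thesis by (simp add: pcT)
  qed
  have qS: "q * S = S" "q * T = 0" "r * S = 0" "r * T = T"
    by (fact DS(2), metis mult.assoc orth(1) qp(2) mult_zero_right,
        metis mult.assoc orth(3) re(2) mult_zero_right, fact DT(2))
  have cq: "c * q = s * q"
    by (metis mult.assoc qp(1) s_def)
  have cr: "c * r = p * c * r + t * r"
    by (metis mult.assoc pe t_def)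
  show "is_pc_inverse c ?y"
  \<comment> \<open>This exponent is large enough for both corners, and positive so that
    \<open>tn\<close> applies.\<close>
  proof (rule is_pc_inverseI[where n = "Suc (k + N)"], unfold prod)
    show "star (q + r) = q + r" by (simp add: star_add DS(1) DT(1))
    show "(q + r) * ?y = ?y"
      by (simp add: algebra_simps qS qS[THEN mult_eq_assoc])
    have 1: "?y * (c * q) = q"
    proof -
      have "T * (s * q) = 0"
        by (metis mult.assoc mult_zero_left orth(2) sp(1))
      moreover have "S * (s * q) = q" using DS(3) by (simp add: mult.assoc)
      ultimately show ?thesis
        unfolding cq by (simp add: algebra_simps)
    qed
    have 2: "?y * (c * r) = r"
    proof -
      have "T * (c * r) = T * (t * r)"
        by (metis Te mult.assoc t_def)
      moreover have "T * (t * r) = r" using DT(3) by (simp add: mult.assoc)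
      ultimately have "T * (c * r) = r" by simp
      then show ?thesis by (simp add: algebra_simps)
    qed
    show "?y * c * (q + r) = q + r"
      using 1 2 by (simp only: distrib_left mult.assoc)
    have "q * c ^ Suc (k + N) = p * c ^ Suc (k + N)"
      using range[of "Suc (k + N)"] by (metis le_SucI le_add2 mult.assoc q_def qp(2) s_def)
    moreover have "r * c ^ Suc (k + N) = e * c ^ Suc (k + N)"
      using k[of "Suc (k + N)"] tn[of "k + N"] by (metis le_SucI le_add1 mult.assoc re(2))
    ultimately show "(q + r) * c ^ Suc (k + N) = c ^ Suc (k + N)"
      by (simp only: distrib_right pe)
  qed
qed

text \<open>Here \<open>u\<close> is block diagonal with second corner the identity, which is its
  own pseudo core inverse.\<close>

lemma is_pc_inverse_add_complement:
  fixes u V p :: "'a::banach_star_algebra"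
  assumes p: "star p = p" "p * p = p" and u: "p * u = u * p" "u * (1 - p) = 1 - p"
    and V: "is_pc_inverse (p * u) V"
  shows "is_pc_inverse u (V + (1 - p))" "u * (V + (1 - p)) = p * u * V + (1 - p)"
proof -
  define e P where "e = 1 - p" and "P = p * u * V"
  note D = is_pc_inverseD[OF V, folded P_def]
  have e: "e * e = e" "e * p = 0" "p * e = 0" "star e = e" "u * e = e"
    using u(2) by (simp_all add: e_def algebra_simps p star_diff star_one)
  have pP: "p * P = P"
    by (simp add: P_def mult_eq_assoc[OF p(2)] mult.assoc)
  then have Pp: "P * p = P"
    using D(1) p(1) star_mult by metis
  have pV: "p * V = V" by (metis D(2) mult.assoc pP)
  have Vp: "V * p = V" by (metis D(4) mult.assoc Pp)
  have orth: "P * e = 0" "e * P = 0" "e * V = 0" "V * e = 0"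
    by (metis e pP Pp pV Vp mult.assoc mult_zero_left mult_zero_right)+
  have uV: "u * V = P"
    unfolding P_def by (metis mult.assoc pV u(1))
  show prod: "u * (V + (1 - p)) = p * u * V + (1 - p)"
    using uV e(5) by (simp add: distrib_left flip: e_def P_def)
  obtain k where k: "\<And>n. n \<ge> k \<Longrightarrow> P * (p * u) ^ n = (p * u) ^ n"
    using D(7) by blast
  have "p * u = p * u * p"
    by (metis mult.assoc p(2) u(1))
  then have pow: "(p * u) ^ Suc k = p * u ^ Suc k"
    by (rule power_corner_left[OF p(2)])
  show "is_pc_inverse u (V + (1 - p))"
  proof (rule is_pc_inverseI[where n = "Suc k"], unfold prod, fold e_def P_def)
    show "star (P + e) = P + e" by (simp only: star_add D(1) e)
    show "(P + e) * (V + e) = V + e"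
      by (simp add: distrib_left distrib_right orth e D(2))
    have "V * u * P = V * (p * u) * P"
      by (metis mult.assoc Vp)
    then have "V * u * P = P" by (simp only: D(3))
    moreover have "e * u * P = 0"
      by (metis e(2) mult.assoc mult_zero_left pP u(1))
    ultimately show "(V + e) * u * (P + e) = P + e"
      by (simp add: distrib_left distrib_right mult.assoc e orth)
    have "P * u ^ Suc k = p * u ^ Suc k"
      using k[of "Suc k"] pow by (metis Pp le_add2 mult.assoc plus_1_eq_Suc)
    then show "(P + e) * u ^ Suc k = u ^ Suc k"
      by (simp only: distrib_right) (simp add: e_def left_diff_distrib)
  qed
qed

theorem theorem3p1:
  fixes a b :: "'a::banach_star_algebra"
  assumes "pc_invertible a" and "pc_invertible b"
    and "a * b = b * a" and "star a * b = b * star a"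
  shows "(pc_invertible (a + b) \<and> spectral_idem a * pc (a + b) * a * pc a = 0) \<longleftrightarrow>
    (pc_invertible (1 + pc a * b) \<and>
     (\<exists>m::nat. m \<ge> drazin_index (1 + pc a * b) \<and>
       (\<Sum>i = 1..m. (1 + pc a * b) ^ (i - 1) * a ^ (i - 1) * spectral_idem (1 + pc a * b)
          * a * (a * pc a - pc a * a) * (a + b) ^ (m - i)) = 0))"
proof -
  define x p e c u W where "x = pc a" and "p = a * x" and "e = 1 - p" and "c = a + b"
    and "u = 1 + x * b" and "W = spectral_idem u"
  have x: "is_pc_inverse a x"
    unfolding x_def by (rule is_pc_inverse_pc[OF assms(1)])
  note D = is_pc_inverseD[OF x, folded p_def]
  have p: "star p = p" "p * p = p"
    using D(1,2,4) by (auto simp: p_def mult.assoc)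
  have e: "star e = e" "e * e = e" "e * p = 0" "p * e = 0"
    by (simp_all add: e_def star_diff star_one p algebra_simps)
  have "star (star a * b) = star (b * star a)"
    by (simp only: assms(4))
  then have bs: "star b * a = a * star b"
    by (simp add: star_mult star_star)
  have bp: "b * p = p * b" and bx: "b * x = x * b"
    using is_pc_inverse_commute[OF x assms(3)[symmetric] bs] by (simp_all add: p_def)
  have px: "p * x = x" "x * p = x" "x * a * p = p"
    using D by (simp_all add: p_def)
  obtain ka where ka: "\<And>n. n \<ge> ka \<Longrightarrow> p * a ^ n = a ^ n"
    using D(7) by blast
  have ap: "a * p = p * a * p"
  proof -
    have "a * p = a ^ (Suc ka + 1) * x ^ (ka + 1)"
      using D(6)[of ka] by (simp add: mult.assoc)
    then show ?thesis using ka[of "Suc ka + 1"] by (metis le_SucI le_add1 mult.assoc trans_le_add1 le_refl)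
  qed
  have cp: "c * p = p * c * p"
    using ap p(2) by (simp add: c_def algebra_simps bp) (metis bp mult.assoc)
  have ea: "e * a = e * a * e"
    using ap by (simp add: e_def algebra_simps)
  have be: "b * e = e * b"
    by (simp add: e_def algebra_simps bp)

  \<comment> \<open>The corner of \<open>c\<close> at \<open>e\<close>\<close>
  have t: "pc_invertible (e * c)"
  proof -
    have "pc_invertible (e * b)"
      using is_pc_inverse_corner(1)[OF is_pc_inverse_pc[OF assms(2)] e(1,2) be[symmetric]]
      unfolding pc_invertible_def by blast
    moreover have "(e * a) ^ Suc ka = 0"
      using ka[of "Suc ka"] unfolding power_corner_left[OF e(2) ea] by (simp add: e_def algebra_simps)
    moreover have "e * a * (e * b) = e * b * (e * a)"
    proof -
      have "e * a * (e * b) = e * a * e * b" by (simp only: mult.assoc)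
      also have "\<dots> = e * (b * a)" by (simp only: ea[symmetric]) (simp only: assms(3) mult.assoc)
      also have "\<dots> = e * b * (e * a)" by (metis be e(2) mult.assoc)
      finally show ?thesis .
    qed
    moreover have "star (e * a) * (e * b) = e * b * star (e * a)"
    proof -
      have "star (e * a) = star a * e" by (simp add: star_mult e)
      moreover have "star (e * a * e) = e * (star a * e)" by (simp add: star_mult e mult.assoc)
      ultimately show ?thesis
        using ea by (metis assms(4) be e(2) mult.assoc)
    qed
    ultimately have "pc_invertible (e * b + e * a)"
      by (rule pc_invertible_add_nilpotent)
    then show ?thesis by (simp add: c_def algebra_simps)
  qed

  \<comment> \<open>The corner of \<open>c\<close> at \<open>p\<close> and its factorization through
    \<open>u\<close>\<close>
  have pu: "p * u = p + x * b" "u * p = p * u" "u * e = e"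
    using px bp by (simp_all add: u_def e_def algebra_simps) (metis mult.assoc)+
  define \<alpha> where "\<alpha> = a * p"
  have \<alpha>: "\<alpha> * p = \<alpha>" "p * \<alpha> = \<alpha>" "x * \<alpha> = p" "\<alpha> * x = p"
    using ap p(2) px by (simp_all add: \<alpha>_def mult.assoc) (simp add: p_def)
  have u\<alpha>: "u * \<alpha> = c * p"
    by (simp add: u_def c_def distrib_right bx[symmetric] mult.assoc \<alpha>(3)) (simp add: \<alpha>_def)
  have \<alpha>u: "\<alpha> * u = c * p"
    by (simp add: u_def c_def distrib_right distrib_left mult_eq_assoc[OF \<alpha>(4)] bp)
      (simp add: \<alpha>_def)
  have xu: "x * u = u * x"
    by (simp add: u_def distrib_right distrib_left bx mult.assoc)

  \<comment> \<open>The condition in (1) as triangularity of the pseudo core inverse\<close>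
  define A where "A = spectral_idem a"
  \<comment> \<open>These relations make \<open>A * z = 0\<close> equivalent to
    \<open>e * z = 0\<close>, that is, to \<open>z = p * z\<close>.\<close>
  have Ap: "A * p = 0" and eA: "e * A = e"
    using spectral_idem_pc[OF x] by (simp_all add: A_def p_def e_def left_diff_distrib)
  have A_iff: "A * y * a * x = 0 \<longleftrightarrow> y * p = p * y * p" for y
  proof
    assume "A * y * a * x = 0"
    then have "e * A * (y * p) = 0"
      by (simp add: p_def mult.assoc)
    then show "y * p = p * y * p"
      by (simp only: eA) (simp add: e_def left_diff_distrib mult.assoc)
  next
    assume y: "y * p = p * y * p"
    have "A * y * a * x = A * (y * p)"
      by (simp add: p_def mult.assoc)
    also have "\<dots> = A * p * (y * p)"
      by (subst y) (simp only: mult.assoc)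
    finally show "A * y * a * x = 0" by (simp add: Ap)
  qed

  \<comment> \<open>Evaluation of the sum in (2)\<close>
  have upow: "u ^ n * a ^ n * p = c ^ n * p" for n
  proof -
    have "u ^ n * a ^ n * p = u ^ n * \<alpha> ^ n * p"
      using power_corner_right(2)[OF p(2) ap, of n] by (simp add: \<alpha>_def mult.assoc)
    also have "\<dots> = (c * p) ^ n * p"
      using power_mult_commuting[of u \<alpha> n] by (simp add: u\<alpha> \<alpha>u)
    also have "\<dots> = c ^ n * p"
      by (rule power_corner_right(2)[OF p(2) cp])
    finally show ?thesis .
  qed

  have W: "W * u ^ n = 0" if "n \<ge> drazin_index u" "pc_invertible u" for n
    using spectral_idem_props(1) that pc_invertible_imp_drazin_invertible W_def by blast
  have We: "W * e = 0" if "pc_invertible u"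
  proof -
    have "u ^ n * e = e" for n
      by (induction n) (simp_all add: mult.assoc pu(3))
    then show ?thesis
      using W[OF order_refl that] by (metis mult.assoc mult_zero_left)
  qed
  have Wp: "W * p = W" if "pc_invertible u"
    using We[OF that] by (simp add: e_def right_diff_distrib)

  \<comment> \<open>\<open>W\<close> absorbs \<open>p\<close> and commutes with
    \<open>c ^ j * p\<close>, so it moves to the front of each summand and leaves a commutator of
    \<open>c\<close> and \<open>p\<close> between powers of \<open>c\<close>.\<close>
  have sum_eq: "(\<Sum>i = 1..m. u ^ (i - 1) * a ^ (i - 1) * W * a * (a * x - x * a) * c ^ (m - i))
      = W * (c ^ m * p) - W * (p * c ^ m)" if u: "pc_invertible u" for m
  proof -
    have comm: "z * W = W * z" if "z * u = u * z" for z
      using spectral_idem_props(3) u pc_invertible_imp_drazin_invertible W_def that by blast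
    have Wc: "c ^ j * p * W = W * (c ^ j * p)" for j
    proof -
      have "c * p * u = u * (c * p)"
        by (metis \<alpha>u mult.assoc u\<alpha>)
      then have "(c * p) ^ j * p * u = u * ((c * p) ^ j * p)"
        using power_commuting_commutes[of "c * p" u j]
        by (simp only: mult.assoc pu(2)[symmetric]) (simp only: mult.assoc[symmetric])
      then show ?thesis
        unfolding power_corner_right(2)[OF p(2) cp] by (rule comm)
    qed
    have pa: "p * (a * (p - x * a)) = c * p - p * c"
    proof -
      have "p * (a * (p - x * a)) = p * a * p - p * p * a"
        by (simp add: p_def algebra_simps)
      then show ?thesis
        using ap by (simp only: p(2)) (simp add: c_def distrib_left distrib_right bp)
    qed
    have "u ^ j * a ^ j * W * a * (a * x - x * a) = W * (c ^ j * (c * p - p * c))" for j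
    proof -
      have "u ^ j * a ^ j * W = u ^ j * a ^ j * p * W"
        using Wp[OF u] comm[OF pu(2)[symmetric]] by (simp add: mult.assoc)
      then have "u ^ j * a ^ j * W = W * (c ^ j * p)"
        by (simp only: upow Wc)
      then have "u ^ j * a ^ j * W * a * (a * x - x * a) = W * (c ^ j * (p * (a * (p - x * a))))"
        by (simp only: p_def mult.assoc)
      then show ?thesis by (simp only: pa)
    qed
    then have "(\<Sum>i = 1..m. u ^ (i - 1) * a ^ (i - 1) * W * a * (a * x - x * a) * c ^ (m - i))
      = - (W * (\<Sum>i = 1..m. c ^ (i - 1) * (p * c - c * p) * c ^ (m - i)))"
      by (simp add: sum_distrib_left flip: sum_negf) (simp add: algebra_simps)
    then show ?thesis
      by (simp only: sum_powers_commutator) (simp add: right_diff_distrib)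
  qed

  \<comment> \<open>The equivalence in its reduced form\<close>
  have "pc_invertible c \<and> A * pc c * a * x = 0 \<longleftrightarrow>
    pc_invertible u \<and> (\<exists>m\<ge>drazin_index u. W * (c ^ m * p) = W * (p * c ^ m))"
  proof
    assume "pc_invertible c \<and> A * pc c * a * x = 0"
    then have y: "is_pc_inverse c (pc c)" and yp: "pc c * p = p * pc c * p"
      using is_pc_inverse_pc A_iff by auto
    define y where "y = pc c"
    note U = is_pc_inverse_upper_block[OF y p cp yp, folded y_def]
    have "\<alpha> * (c * p) = c * p * \<alpha>" "x * (c * p) = c * p * x"
      by (metis \<alpha>u u\<alpha> mult.assoc, metis \<alpha> u\<alpha> xu mult.assoc)
    moreover have xs: "x * (c * p) = p * u"
      by (metis \<alpha>(3) \<alpha>u mult.assoc)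
    moreover have "x * \<alpha> * (c * p) = c * p"
      using cp by (simp add: \<alpha>(3) mult.assoc)
    ultimately have V: "is_pc_inverse (p * u) (\<alpha> * (y * p))" "p * u * (\<alpha> * (y * p)) = c * y * p"
      using is_pc_inverse_mult_commuting[OF U(1), of \<alpha> x] by (simp_all add: \<alpha> U(2))
    note v = is_pc_inverse_add_complement[OF p pu(2)[symmetric] pu(3)[unfolded e_def] V(1), folded e_def,
        unfolded V(2)]
    have u: "pc_invertible u"
      using v(1) pc_invertible_def by blast
    have "W * (c * y * p + e) = 0"
      using spectral_idem_pc(1)[OF v(1)] unfolding v(2) W_def .
    then have Wy: "W * (c * y * p) = 0"
      by (simp add: distrib_left We[OF u])
    obtain k where k: "\<And>n. n \<ge> k \<Longrightarrow> c * y * c ^ n = c ^ n"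
      using is_pc_inverseD(7)[OF y] unfolding y_def by blast
    \<comment> \<open>From \<open>k\<close> on, \<open>c * y\<close> fixes \<open>c ^ m\<close>, so
      \<open>W\<close> kills \<open>p * c ^ m\<close> and with it
      \<open>c ^ m * p = p * c ^ m * p\<close>: both sides vanish.\<close>
    define m where "m = max k (drazin_index u)"
    have "W * (p * c ^ m) = W * (c * y * p) * c ^ m"
      using k[of m] U(3) by (simp add: m_def mult.assoc)
    then have Wm: "W * (p * c ^ m) = 0" by (simp add: Wy)
    then have "W * (p * c ^ m) * p = 0" by simp
    then have "W * (c ^ m * p) = 0"
      using power_corner_right(1)[OF p(2) cp, of m] by (simp add: mult.assoc)
    with Wm u show "pc_invertible u \<and> (\<exists>m\<ge>drazin_index u. W * (c ^ m * p) = W * (p * c ^ m))"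
      by (metis m_def max.cobounded2)
  next
    assume "pc_invertible u \<and> (\<exists>m\<ge>drazin_index u. W * (c ^ m * p) = W * (p * c ^ m))"
    then obtain m where u: "pc_invertible u" and m: "m \<ge> drazin_index u"
        "W * (c ^ m * p) = W * (p * c ^ m)"
      by blast
    then obtain v where v: "is_pc_inverse u v"
      using pc_invertible_def by blast
    obtain T where T: "is_pc_inverse ((1 - p) * c) T"
      using t pc_invertible_def e_def by blast
    \<comment> \<open>The bound on \<open>m\<close> enters here: \<open>W * u ^ m = 0\<close> kills
      one side of the equation, hence also the other.\<close>
    have "W * (c ^ m * p) = W * u ^ m * (a ^ m * p)"
      by (simp only: upow[symmetric] mult.assoc)
    then have Wm: "W * (p * c ^ m) = 0"
      using W[OF m(1) u] m(2) by simp
    \<comment> \<open>Whatever \<open>W\<close> kills is fixed by \<open>u * v\<close>; this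
      supplies the range condition for the triangular construction.\<close>
    have uv: "u * v * (p * c ^ n) = p * c ^ n" if "n \<ge> m" for n
    proof -
      have "p * c ^ n = p * c ^ m * c ^ (n - m)"
        using that by (simp add: mult.assoc flip: power_add)
      then have "W * (p * c ^ n) = 0"
        using Wm by (metis mult.assoc mult_zero_left)
      moreover have "u * v * W * (p * c ^ n) = W * (p * c ^ n) - p * c ^ n + u * v * (p * c ^ n)"
        unfolding W_def spectral_idem_pc(2)[OF v] by (simp add: algebra_simps)
      ultimately show ?thesis
        by (simp add: mult.assoc)
    qed
    note V = is_pc_inverse_corner[OF v p pu(2)[symmetric]]
    have "x * (p * u) = p * u * x" "\<alpha> * (p * u) = p * u * \<alpha>"
      by (metis px(1,2) xu mult.assoc pu(2), metis \<alpha>(1,2) \<alpha>u u\<alpha> mult.assoc pu(2))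
    moreover have "\<alpha> * (p * u) = c * p"
      by (metis \<alpha>(1) \<alpha>u mult.assoc)
    moreover have "\<alpha> * x * (p * u) = p * u"
      by (simp add: \<alpha>(4) mult_eq_assoc[OF p(2)])
    ultimately have S: "is_pc_inverse (c * p) (x * (p * v))" "c * p * (x * (p * v)) = p * (u * v)"
      using is_pc_inverse_mult_commuting[OF V(1), of x \<alpha>] by (simp_all add: \<alpha> V(2))
    have "c * p * (x * (p * v)) * (p * c ^ n) = p * c ^ n" if "n \<ge> m" for n
      unfolding S(2) using uv[OF that] by (simp add: mult.assoc mult_eq_assoc[OF p(2)])
    note Y = is_pc_inverse_triangular[OF p cp S(1) T this]
    define y where "y = x * (p * v) + T - x * (p * v) * c * T"
    have y: "is_pc_inverse c y" unfolding y_def by (rule Y(1))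
    have "y * p = x * (p * v) * p"
      using Y(3) by (simp add: y_def distrib_right left_diff_distrib mult.assoc)
    then have "y * p = p * y * p"
      using Y(2) by (metis mult.assoc)
    with y show "pc_invertible c \<and> A * pc c * a * x = 0"
      using A_iff pc_eq pc_invertible_def by metis
  qed
  then show ?thesis
    using sum_eq unfolding A_def W_def u_def x_def c_def by auto
qed

end
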